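(* Let $X$ be a set, $k$ a field, $I$ an ideal of $kRig[X]$ and $>$ a monomial ordering on the free commutative semiring $Rig[X]$. Then there exists a unique reduced Gröbner-Shirshov basis $S$ for $I$.
   Context: A commutative semiring $(A,\circ,\cdot,\theta,1)$ consists of two commutative monoids $(A,\circ,\theta)$ and $(A,\cdot,1)$ such that $\theta\cdot a=\theta$ for all $a$ and $\cdot$ distributes over $\circ$. $Rig[X]$ is the free commutative semiring on $X$; with $[X]$ the free commutative monoid on $X$, its elements (called monomials) are the finite multisets $u_1\circ u_2\circ\cdots\circ u_n$ with $u_i\in[X]$, $n\ge0$ ($n=0$ gives $\theta$). $kRig[X]$ is the $k$-vector space with basis $Rig[X]$, with $\circ$ and $\cdot$ extended bilinearly; it is regarded as an $\Omega$-algebra with $\Omega=\{\cdot,\circ\}$, "ideal" means $\Omega$-ideal, i.e. ideal with respect to both operations, and $Id(S)$ is the ideal generated by $S$. Elements of $kRig[X]$ are called polynomials. (The basis element $\theta$ is different from the zero vector $0$.) For $u,v\in[X]$, $lcm_\cdot(u,v)$ is their least common multiple in $[X]$. For monomials $u=w_1\circ\cdots\circ w_m\circ u_{m+1}\circ\cdots\circ u_n$ and $v=w_1\circ\cdots\circ w_m\circ v_{m+1}\circ\cdots\circ v_t$ with all $w_l,u_i,v_j\in[X]$ and $u_i\ne v_j$ for all $i,j>m$, put $lcm_\circ(u,v)=w_1\circ\cdots\circ w_m\circ u_{m+1}\circ\cdots\circ u_n\circ v_{m+1}\circ\cdots\circ v_t$. Let $\star\notin X$. A $\star$-monomial is a monomial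 in $Rig[X\cup\{\star\}]$ with exactly one occurrence of $\star$; $u|_s$ denotes the result of substituting $s$ for $\star$ in $u$. A monomial ordering on $Rig[X]$ is a well ordering $>$ such that $w>v$ implies $u|_w>u|_v$ for all monomials $v,w$ and all $\star$-monomials $u$. For a nonzero polynomial $f$, $\bar f$ is its leading (largest) monomial; $f$ is monic if $\bar f$ has coefficient $1$. Compositions: let $f,g$ be monic with $\bar f=u_1\circ\cdots\circ u_n$, $\bar g=v_1\circ\cdots\circ v_m$, $u_i,v_j\in[X]$. For each pair $(i,j)$ let $a,b\in[X]$ be the elements with $lcm_\cdot(u_i,v_j)=au_i=bv_j$. The corresponding composition is $(f,g)_w=af\circ u-bg\circ v$, where $w=lcm_\circ(a\bar f,b\bar g)=a\bar f\circ u=b\bar g\circ v$. For a set $S$ of monic polynomials and a monomial $w$, a polynomial $h$ is trivial modulo $(S,w)$ if $h=\sum_i\alpha_ia_is_i\circ u_i$ (finite sum) with $\alpha_i\in k$, $a_i\in[X]$, $u_i\in Rig[X]$, $s_i\in S$ and $a_i\overline{s_i}\circ u_i<w$ for all $i$. A set $S$ of monic polynomials is a Gröbner-Shirshov basis in $kRig[X]$ if every composition $(f,g)_w$ with $f,g\in S$ is trivial modulo $(S,w)$; it is then called a Gröbner-Shirshov basis for the ideal $Id(S)$. $Irr(S)=\{w\in Rig[X]\mid w\ne a\bar s\circ u\text{ for any }a\in[X],u\in Rig[X],s\in S\}$. For $s=\sum_{i=1}^n\alpha_iu_i$ with $0\ne\alpha_i\in k$ and distinct $u_i\in Rig[X]$,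 $supp(s)=\{u_1,\dots,u_n\}$. A Gröbner-Shirshov basis $S$ is reduced if $supp(s)\subseteq Irr(S-\{s\})$ for every $s\in S$.
   Formalization: Taken literally the claim is false (if char k ≠ 2, {1+θ} and {θ} are both reduced bases for kRig[X]), so a Gröbner-Shirshov basis S for I is also required to satisfy: every element of I is a finite sum of terms αas∘u with α∈k, a∈[X], s∈S, u∈Rig[X]. *)

theory Defs
  imports Complex_Main "HOL-Library.Multiset" "HOL-Library.Poly_Mapping"
begin

section \<open>The free commutative semiring\<close>

text \<open>
  The free commutative monoid \<open>[X]\<close> consists of the finite multisets over \<open>X\<close>, written
  additively: the product \<open>a \<cdot> u\<close> of the text is \<open>a + u\<close>, its unit \<open>1\<close> is \<open>{#}\<close>, divisibility is
  \<open>\<subseteq>#\<close> and the least common multiple is the multiset union \<open>\<union>#\<close>.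
  A monomial of \<open>Rig[X]\<close> is a finite multiset of such elements: the operation \<open>\<circ>\<close> is \<open>+\<close>, the
  constant \<open>\<theta>\<close> is \<open>{#}\<close>, and \<open>u\<close> in \<open>[X]\<close> is identified with \<open>{#u#}\<close>.
  The set \<open>X\<close> is an explicit carrier, so it may be empty.
\<close>

type_synonym 'x rig = "'x multiset multiset"

definition Mon :: "'x set \<Rightarrow> 'x multiset set"
  where "Mon X = {u. set_mset u \<subseteq> X}"

definition Rig :: "'x set \<Rightarrow> 'x rig set"
  where "Rig X = {U. set_mset U \<subseteq> Mon X}"

definition rig_times :: "'x rig \<Rightarrow> 'x rig \<Rightarrow> 'x rig"
  where "rig_times U V = (\<Sum>u\<in>#U. image_mset (\<lambda>v. u + v) V)"

text \<open>
  \<open>lcm\<^sub>\<circ>\<close>: the common part of the two monomials, followed by what remains of each.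
\<close>

definition lcm_circ :: "'x rig \<Rightarrow> 'x rig \<Rightarrow> 'x rig"
  where "lcm_circ U V = (U \<inter># V) + (U - V) + (V - U)"


section \<open>Monomials with a hole and monomial orderings\<close>

text \<open>The letter \<open>\<star>\<close> is \<open>None\<close>; the letters from \<open>X\<close> are tagged with \<open>Some\<close>.\<close>

definition star_monomials :: "'x set \<Rightarrow> 'x option rig set"
  where "star_monomials X =
    {u \<in> Rig (insert None (Some ` X)). count (\<Sum>\<^sub># u) None = 1}"

text \<open>
  Substitution of \<open>s\<close> for \<open>\<star>\<close>: the summand \<open>p = \<star>\<^sup>n \<cdot> a\<close>, with \<open>a\<close> in \<open>[X]\<close>, becomes the product
  \<open>s \<cdot> \<dots> \<cdot> s \<cdot> a\<close> computed in \<open>Rig[X]\<close>.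
\<close>

definition rig_subst :: "'x option rig \<Rightarrow> 'x rig \<Rightarrow> 'x rig"
  where "rig_subst u s =
    (\<Sum>p\<in>#u. (rig_times s ^^ count p None) {#image_mset the (filter_mset (\<lambda>l. l \<noteq> None) p)#})"

text \<open>
  An ordering is given by its reflexive relation \<open>r\<close>, as in \<^const>\<open>well_order_on\<close>.
\<close>

definition rig_less :: "'x rig rel \<Rightarrow> 'x rig \<Rightarrow> 'x rig \<Rightarrow> bool"
  where "rig_less r v w \<longleftrightarrow> (v, w) \<in> r \<and> v \<noteq> w"

definition monomial_ordering :: "'x set \<Rightarrow> 'x rig rel \<Rightarrow> bool"
  where "monomial_ordering X r \<longleftrightarrow>
    well_order_on (Rig X) r \<and>
    (\<forall>v\<in>Rig X. \<forall>w\<in>Rig X. \<forall>u\<in>star_monomials X.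
       rig_less r v w \<longrightarrow> rig_less r (rig_subst u v) (rig_subst u w))"


section \<open>The semiring algebra\<close>

text \<open>
  Elements of \<open>kRig[X]\<close> are finitely supported maps from monomials to \<open>k\<close>. The ring
  multiplication that \<^theory>\<open>HOL-Library.Poly_Mapping\<close> puts on this type is the convolution along
  \<open>+\<close> on monomials, that is, the bilinear extension of \<open>\<circ>\<close>; its unit is the basis element
  \<open>\<theta>\<close>, different from the zero vector \<open>0\<close>. The bilinear extension of \<open>\<cdot>\<close> is \<open>dot\<close>.
\<close>

type_synonym ('x, 'k) krig = "'x rig \<Rightarrow>\<^sub>0 'k"

definition kRig :: "'x set \<Rightarrow> ('x, 'k::field) krig set"
  where "kRig X = {f. Poly_Mapping.keys f \<subseteq> Rig X}"

abbreviation basis_elem :: "'x rig \<Rightarrow> ('x, 'k::field) krig"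
  where "basis_elem U \<equiv> Poly_Mapping.single U 1"

abbreviation circ :: "('x, 'k::field) krig \<Rightarrow> ('x, 'k) krig \<Rightarrow> ('x, 'k) krig"  (infixl "\<odot>" 70)
  where "f \<odot> g \<equiv> f * g"

definition dot :: "('x, 'k::field) krig \<Rightarrow> ('x, 'k) krig \<Rightarrow> ('x, 'k) krig"
  where "dot f g = (\<Sum>U\<in>Poly_Mapping.keys f. \<Sum>V\<in>Poly_Mapping.keys g.
    Poly_Mapping.single (rig_times U V) (Poly_Mapping.lookup f U * Poly_Mapping.lookup g V))"

definition scale :: "'k \<Rightarrow> ('x, 'k::field) krig \<Rightarrow> ('x, 'k) krig"
  where "scale c f = Poly_Mapping.map (\<lambda>d. c * d) f"

text \<open>Both operations are commutative, so one-sided closure suffices.\<close>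

definition omega_ideal :: "'x set \<Rightarrow> ('x, 'k::field) krig set \<Rightarrow> bool"
  where "omega_ideal X I \<longleftrightarrow>
    I \<subseteq> kRig X \<and> 0 \<in> I \<and>
    (\<forall>f\<in>I. \<forall>g\<in>I. f + g \<in> I) \<and>
    (\<forall>c. \<forall>f\<in>I. scale c f \<in> I) \<and>
    (\<forall>h\<in>kRig X. \<forall>f\<in>I. dot h f \<in> I \<and> h \<odot> f \<in> I)"

definition Id_gen :: "'x set \<Rightarrow> ('x, 'k::field) krig set \<Rightarrow> ('x, 'k) krig set"
  where "Id_gen X S = (omega_ideal X) hull S"

definition lead :: "'x rig rel \<Rightarrow> ('x, 'k::field) krig \<Rightarrow> 'x rig"
  where "lead r f = (THE w. w \<in> Poly_Mapping.keys f \<and> (\<forall>v\<in>Poly_Mapping.keys f. (v, w) \<in> r))"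

definition monic :: "'x rig rel \<Rightarrow> ('x, 'k::field) krig \<Rightarrow> bool"
  where "monic r f \<longleftrightarrow> f \<noteq> 0 \<and> Poly_Mapping.lookup f (lead r f) = 1"


section \<open>Groebner-Shirshov bases\<close>

text \<open>
  \<open>ctx a f U\<close> is \<open>a f \<circ> U\<close> for a polynomial \<open>f\<close>, and \<open>ctx_mon a V U\<close> is \<open>a V \<circ> U\<close> for a monomial
  \<open>V\<close>.
\<close>

definition ctx_mon :: "'x multiset \<Rightarrow> 'x rig \<Rightarrow> 'x rig \<Rightarrow> 'x rig"
  where "ctx_mon a V U = rig_times {#a#} V + U"

definition ctx :: "'x multiset \<Rightarrow> ('x, 'k::field) krig \<Rightarrow> 'x rig \<Rightarrow> ('x, 'k) krig"
  where "ctx a f U = dot (basis_elem {#a#}) f \<odot> basis_elem U"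

text \<open>
  \<open>is_composition r f g w h\<close>: \<open>h\<close> is a composition \<open>(f,g)\<^sub>w\<close>, belonging to some choice of factors
  \<open>u\<close> of the leading monomial of \<open>f\<close> and \<open>v\<close> of the leading monomial of \<open>g\<close>.
\<close>

definition is_composition ::
    "'x rig rel \<Rightarrow> ('x, 'k::field) krig \<Rightarrow> ('x, 'k) krig \<Rightarrow> 'x rig \<Rightarrow> ('x, 'k) krig \<Rightarrow> bool"
  where "is_composition r f g w h \<longleftrightarrow>
    (\<exists>u v a b U V. u \<in># lead r f \<and> v \<in># lead r g \<and>
       a + u = u \<union># v \<and> b + v = u \<union># v \<and>
       w = lcm_circ (rig_times {#a#} (lead r f)) (rig_times {#b#} (lead r g)) \<and>
       w = ctx_mon a (lead r f) U \<and> w = ctx_mon b (lead r g) V \<and>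
       h = ctx a f U - ctx b g V)"

text \<open>
  \<open>is_combination X S C h\<close>: \<open>h\<close> is a finite sum of terms \<open>\<alpha> a s \<circ> u\<close> with \<open>s\<close> in \<open>S\<close>, where each
  triple \<open>(a, s, u)\<close> satisfies the side condition \<open>C\<close>.
\<close>

definition is_combination ::
    "'x set \<Rightarrow> ('x, 'k::field) krig set \<Rightarrow> ('x multiset \<Rightarrow> ('x, 'k) krig \<Rightarrow> 'x rig \<Rightarrow> bool) \<Rightarrow>
     ('x, 'k) krig \<Rightarrow> bool"
  where "is_combination X S C h \<longleftrightarrow>
    (\<exists>(n::nat) \<alpha> a s u.
       (\<forall>i<n. a i \<in> Mon X \<and> s i \<in> S \<and> u i \<in> Rig X \<and> C (a i) (s i) (u i)) \<and>
       h = (\<Sum>i<n. scale (\<alpha> i) (ctx (a i) (s i) (u i))))"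

definition trivial_mod ::
    "'x set \<Rightarrow> 'x rig rel \<Rightarrow> ('x, 'k::field) krig set \<Rightarrow> 'x rig \<Rightarrow> ('x, 'k) krig \<Rightarrow> bool"
  where "trivial_mod X r S w h \<longleftrightarrow>
    is_combination X S (\<lambda>a s u. rig_less r (ctx_mon a (lead r s) u) w) h"

definition GS_basis :: "'x set \<Rightarrow> 'x rig rel \<Rightarrow> ('x, 'k::field) krig set \<Rightarrow> bool"
  where "GS_basis X r S \<longleftrightarrow>
    S \<subseteq> kRig X \<and> (\<forall>s\<in>S. monic r s) \<and>
    (\<forall>f\<in>S. \<forall>g\<in>S. \<forall>w h. is_composition r f g w h \<longrightarrow> trivial_mod X r S w h)"

text \<open>
  A Groebner-Shirshov basis \<open>S\<close> is a basis for the ideal \<open>I\<close> if \<open>I\<close> is the ideal generated by \<open>S\<close>,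
  where generation is understood in the sense that the Composition-Diamond lemma needs: every
  element of \<open>I\<close> is a linear combination of the polynomials \<open>u|\<^sub>s\<close>, i.e. \<open>a s \<circ> u\<close>, with
  \<open>s\<close> in \<open>S\<close>.

  The last conjunct is not a consequence of \<open>Id_gen X S = I\<close>, since \<open>\<cdot>\<close> distributes over \<open>\<circ>\<close> only
  for monomials and not for polynomials: \<open>f \<cdot> (1 \<circ> 1)\<close> need not be a combination of
  terms \<open>a f \<circ> u\<close>. For example, with \<open>f = 1 + \<theta>\<close> one has
  \<open>f \<cdot> (1 \<circ> 1) - f \<circ> 1 + f = (1 \<circ> 1 + \<theta>) - (1 \<circ> 1 + 1) + (1 + \<theta>) = 2 \<theta>\<close>.
  Hence, if \<open>2 \<noteq> 0\<close> in \<open>k\<close>, both \<open>{1 + \<theta>}\<close> and \<open>{\<theta>}\<close> are reduced Groebner-Shirshov bases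
  generating the ideal \<open>kRig[X]\<close>, and without the conjunct a reduced basis would not be unique.
\<close>

definition GS_basis_for ::
    "'x set \<Rightarrow> 'x rig rel \<Rightarrow> ('x, 'k::field) krig set \<Rightarrow> ('x, 'k) krig set \<Rightarrow> bool"
  where "GS_basis_for X r S I \<longleftrightarrow>
    GS_basis X r S \<and> Id_gen X S = I \<and>
    (\<forall>h\<in>I. is_combination X S (\<lambda>a s u. True) h)"

definition Irr :: "'x set \<Rightarrow> 'x rig rel \<Rightarrow> ('x, 'k::field) krig set \<Rightarrow> 'x rig set"
  where "Irr X r S =
    {w \<in> Rig X. \<forall>a\<in>Mon X. \<forall>u\<in>Rig X. \<forall>s\<in>S. w \<noteq> ctx_mon a (lead r s) u}"

definition reduced_GS_basis_for ::
    "'x set \<Rightarrow> 'x rig rel \<Rightarrow> ('x, 'k::field) krig set \<Rightarrow> ('x, 'k) krig set \<Rightarrow> bool"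
  where "reduced_GS_basis_for X r S I \<longleftrightarrow>
    GS_basis_for X r S I \<and> (\<forall>s\<in>S. Poly_Mapping.keys s \<subseteq> Irr X r (S - {s}))"

end

theory Submission
  imports Defs
begin

text \<open>
  For fixed \<open>a\<close> and \<open>U\<close> the map \<open>V \<mapsto> a V \<circ> U\<close> on monomials is injective, and it is strictly
  increasing for a monomial ordering, because it is a substitution into a monomial with a hole.
  Hence \<open>a f \<circ> U\<close> has leading monomial \<open>a V \<circ> U\<close> when \<open>f\<close> has leading monomial \<open>V\<close>, and
  \<open>a V \<circ> U\<close> is never smaller than \<open>V\<close>. Say that it is a multiple of \<open>V\<close>; this is a
  partial order on monomials contained in the given well-ordering.

  Let \<open>L\<close> be the set of leading monomials of the nonzero elements of \<open>I\<close>. It is closed under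
  multiples, and by well-foundedness each of its elements is a multiple of a minimal one. Let
  \<open>R\<close> be the set of monic elements of \<open>I\<close> whose leading monomial is minimal in \<open>L\<close> and which
  have no other monomial in \<open>L\<close> (\<open>reduced_elements\<close>). The reduced bases of \<open>I\<close> turn out to be
  \<open>R\<close> and nothing else.

  \<^item> Two elements of \<open>R\<close> with the same leading monomial are equal: no monomial of their
    difference lies in \<open>L\<close>, whereas the difference is in \<open>I\<close>.

  \<^item> \<open>R\<close> is a reduced basis. Well-founded induction reduces every monomial modulo \<open>I\<close> to a
    combination of monomials outside \<open>L\<close> (\<open>reduce_monomial\<close>), so that each minimal element of
    \<open>L\<close> is the leading monomial of an element of \<open>R\<close>. Then leading terms of elements of \<open>I\<close>
    can be cancelled one after the other by terms \<open>a s \<circ> u\<close> with \<open>s\<close> in \<open>R\<close>, which gives both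
    the triviality of the compositions and the generation of \<open>I\<close> (\<open>GS_basis_forI\<close>).

  \<^item> Every reduced basis \<open>S\<close> equals \<open>R\<close>. By the Composition-Diamond lemma
    (\<open>composition_diamond\<close>), \<open>L\<close> consists of the multiples of the leading monomials of \<open>S\<close>.
    Being reduced then says that every element of \<open>S\<close> is in \<open>R\<close>; as each
    minimal element of \<open>L\<close> is the leading monomial of some element of \<open>S\<close>, uniqueness in \<open>R\<close>
    gives equality.

  The Composition-Diamond lemma rests on two facts. If two terms \<open>a f \<circ> U\<close> and \<open>b g \<circ> V\<close> have
  the same leading monomial, their difference is a combination of terms with smaller leading
  monomials (\<open>GS_basis_confluent\<close>): either their leading parts occupy disjoint summands and the
  tails of \<open>f\<close> and \<open>g\<close> do it, or the difference is a composition inside a context. By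
  \<open>lead_span_confluent\<close> this local property implies that no cancellation of leading terms can
  produce a new leading monomial.
\<close>

section \<open>The vector space and the terms \<open>a f \<circ> U\<close>\<close>

lemma lookup_scale [simp]: "Poly_Mapping.lookup (scale c f) v = c * Poly_Mapping.lookup f v"
  by (simp add: scale_def Poly_Mapping.map.rep_eq when_def)

interpretation krig: vector_space "scale :: 'k::field \<Rightarrow> ('x, 'k) krig \<Rightarrow> ('x, 'k) krig"
  by standard (auto intro!: poly_mapping_eqI simp: lookup_add algebra_simps)

lemma krig_scale_eq_mult: "scale c f = Poly_Mapping.single {#} c * f"
  unfolding scale_def by (metis mult_map_scale_conv_mult zero_multiset_def)

lemma scale_single [simp]: "scale c (Poly_Mapping.single v d) = Poly_Mapping.single v (c * d)"
  by (auto intro!: poly_mapping_eqI simp: lookup_single when_def)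

lemma keys_scale: "Poly_Mapping.keys (scale c f) \<subseteq> Poly_Mapping.keys f"
  by (auto simp: in_keys_iff)

lemma krig_sum_monomials:
  "f = (\<Sum>v\<in>Poly_Mapping.keys f. scale (Poly_Mapping.lookup f v) (basis_elem v))"
  by (rule poly_mapping_eqI)
     (auto simp: lookup_sum lookup_single when_def in_keys_iff if_distrib[of "(*) _"] cong: if_cong)

lemma ctx_mon_eq: "ctx_mon a V U = image_mset ((+) a) V + U"
  by (simp add: ctx_mon_def rig_times_def)

lemma ctx_mon_ctx_mon:
  "ctx_mon c (ctx_mon a V U) W = ctx_mon (c + a) V (ctx_mon c U W)"
  by (simp add: ctx_mon_eq image_mset.compositionality o_def add.assoc cong: image_mset_cong)

lemma ctx_mon_empty [simp]: "ctx_mon {#} V {#} = V"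
  by (simp add: ctx_mon_eq multiset.map_ident_strong)

lemma inj_ctx_mon: "inj (\<lambda>V. ctx_mon a V U)"
  
  by (rule injI) (auto simp: ctx_mon_eq dest: injD[OF multiset.inj_map[of "(+) a"], rotated] intro: injI)

lemma ctx_mon_in_Rig: "a \<in> Mon X \<Longrightarrow> V \<in> Rig X \<Longrightarrow> U \<in> Rig X \<Longrightarrow> ctx_mon a V U \<in> Rig X"
  by (auto simp: ctx_mon_eq Rig_def Mon_def subset_iff)

lemma Mon_add [simp]: "a + b \<in> Mon X \<longleftrightarrow> a \<in> Mon X \<and> b \<in> Mon X"
  by (auto simp: Mon_def)

lemma Rig_add [simp]: "U + V \<in> Rig X \<longleftrightarrow> U \<in> Rig X \<and> V \<in> Rig X"
  by (auto simp: Rig_def)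

lemma empty_in_Mon [simp]: "{#} \<in> Mon X" and empty_in_Rig [simp]: "{#} \<in> Rig X"
  by (auto simp: Mon_def Rig_def)

lemma ctx_eq_sum:
  "ctx a f U = (\<Sum>v\<in>Poly_Mapping.keys f. Poly_Mapping.single (ctx_mon a v U) (Poly_Mapping.lookup f v))"
  by (simp add: ctx_def dot_def sum_distrib_right mult_single ctx_mon_def)

text \<open>
  By injectivity of \<open>V \<mapsto> a V \<circ> U\<close>, no coefficients of \<open>f\<close> are merged in \<open>a f \<circ> U\<close>. This
  formula makes the linearity of \<open>f \<mapsto> a f \<circ> U\<close> a matter of comparing coefficients.
\<close>

lemma lookup_ctx:
  "Poly_Mapping.lookup (ctx a f U) w =
     (if w \<in> range (\<lambda>V. ctx_mon a V U)
      then Poly_Mapping.lookup f (inv (\<lambda>V. ctx_mon a V U) w) else 0)"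
proof (cases "w \<in> range (\<lambda>V. ctx_mon a V U)")
  case True
  then obtain v where w: "w = ctx_mon a v U"
    by auto
  have "Poly_Mapping.lookup (ctx a f U) w =
      (\<Sum>v'\<in>Poly_Mapping.keys f. if v' = v then Poly_Mapping.lookup f v' else 0)"
    by (auto simp: ctx_eq_sum lookup_sum lookup_single when_def w inj_eq[OF inj_ctx_mon] intro!: sum.cong)
  also have "\<dots> = Poly_Mapping.lookup f v"
    by (simp add: in_keys_iff)
  finally show ?thesis
    using inv_f_f[OF inj_ctx_mon[of a U], of v] by (simp add: w)
next
  case False
  then show ?thesis
    by (auto simp: ctx_eq_sum lookup_sum lookup_single when_def intro!: sum.neutral)
qed

lemma lookup_ctx_ctx_mon [simp]:
  "Poly_Mapping.lookup (ctx a f U) (ctx_mon a v U) = Poly_Mapping.lookup f v"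
  using inv_f_f[OF inj_ctx_mon[of a U], of v] by (simp add: lookup_ctx)

lemma keys_ctx: "Poly_Mapping.keys (ctx a f U) = (\<lambda>v. ctx_mon a v U) ` Poly_Mapping.keys f"
  by (auto simp: in_keys_iff lookup_ctx inv_f_f[OF inj_ctx_mon] split: if_splits intro!: imageI)

lemma ctx_scale: "ctx a (scale c f) U = scale c (ctx a f U)"
  and ctx_add: "ctx a (f + g) U = ctx a f U + ctx a g U"
  and ctx_diff: "ctx a (f - g) U = ctx a f U - ctx a g U"
  and ctx_zero: "ctx a 0 U = 0"
  by (auto intro!: poly_mapping_eqI simp: lookup_ctx lookup_add lookup_minus)

lemma ctx_ctx: "ctx c (ctx a f U) W = ctx (c + a) f (ctx_mon c U W)"
proof (rule poly_mapping_eqI)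
  fix w
  show "Poly_Mapping.lookup (ctx c (ctx a f U) W) w = Poly_Mapping.lookup (ctx (c + a) f (ctx_mon c U W)) w"
  proof (cases "\<exists>v. w = ctx_mon c (ctx_mon a v U) W")
    case True
    then show ?thesis
      by (metis lookup_ctx_ctx_mon ctx_mon_ctx_mon)
  next
    case False
    then have "w \<notin> Poly_Mapping.keys (ctx c (ctx a f U) W)"
      "w \<notin> Poly_Mapping.keys (ctx (c + a) f (ctx_mon c U W))"
      by (auto simp: keys_ctx ctx_mon_ctx_mon)
    then show ?thesis
      by (simp add: in_keys_iff)
  qed
qed

lemma single_mult_ctx: "Poly_Mapping.single V c * ctx a f U = scale c (ctx a f (U + V))"
proof -
  let ?D = "dot (basis_elem {#a#}) f"
  have "Poly_Mapping.single V c * (?D * basis_elem U) = ?D * (Poly_Mapping.single V c * basis_elem U)"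
    by (rule mult.left_commute)
  also have "Poly_Mapping.single V c * basis_elem U = Poly_Mapping.single {#} c * basis_elem (U + V)"
    by (simp add: mult_single add.commute)
  also have "?D * \<dots> = Poly_Mapping.single {#} c * (?D * basis_elem (U + V))"
    by (rule mult.left_commute)
  finally show ?thesis
    by (simp only: ctx_def krig_scale_eq_mult)
qed

text \<open>
  The product \<open>p \<circ> a f \<circ> U\<close> with a polynomial \<open>p\<close> stays in the span of the terms \<open>a f \<circ> u\<close>;
  the corresponding assertion for the other product \<open>\<cdot>\<close> can fail, as it distributes over \<open>\<circ>\<close> only
  on monomials.
\<close>

lemma mult_ctx:
  "p * ctx a f U =
    (\<Sum>v\<in>Poly_Mapping.keys p. scale (Poly_Mapping.lookup p v) (ctx a f (U + v)))"
  by (subst krig_sum_monomials[of p]) (simp add: sum_distrib_right single_mult_ctx)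

lemma ctx_in_kRig: "a \<in> Mon X \<Longrightarrow> f \<in> kRig X \<Longrightarrow> U \<in> Rig X \<Longrightarrow> ctx a f U \<in> kRig X"
  by (auto simp: kRig_def keys_ctx intro: ctx_mon_in_Rig)

text \<open>
  The generators over which \<^const>\<open>is_combination\<close> ranges, collected in a set in order to have
  the calculus of linear spans at hand.
\<close>

definition ctx_terms ::
    "'x set \<Rightarrow> ('x, 'k::field) krig set \<Rightarrow> ('x multiset \<Rightarrow> ('x, 'k) krig \<Rightarrow> 'x rig \<Rightarrow> bool) \<Rightarrow> ('x, 'k) krig set"
  where "ctx_terms X S C = {ctx a s u | a s u. a \<in> Mon X \<and> s \<in> S \<and> u \<in> Rig X \<and> C a s u}"

lemma ctx_termsI: "a \<in> Mon X \<Longrightarrow> s \<in> S \<Longrightarrow> u \<in> Rig X \<Longrightarrow> C a s u \<Longrightarrow> ctx a s u \<in> ctx_terms X S C"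
  unfolding ctx_terms_def by blast

lemma ctx_terms_mono: "(\<And>a s u. C a s u \<Longrightarrow> C' a s u) \<Longrightarrow> ctx_terms X S C \<subseteq> ctx_terms X S C'"
  unfolding ctx_terms_def by blast

lemma is_combination_iff_span:
  "is_combination X S C h \<longleftrightarrow> h \<in> krig.span (ctx_terms X S C)"
proof
  assume "is_combination X S C h"
  then obtain n :: nat and \<alpha> a s u where
      t: "\<forall>i<n. a i \<in> Mon X \<and> s i \<in> S \<and> u i \<in> Rig X \<and> C (a i) (s i) (u i)"
      and h: "h = (\<Sum>i<n. scale (\<alpha> i) (ctx (a i) (s i) (u i)))" 
    unfolding is_combination_def by blast
  have "ctx (a i) (s i) (u i) \<in> ctx_terms X S C" if "i < n" for i
    using t that by (simp add: ctx_termsI)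
  then show "h \<in> krig.span (ctx_terms X S C)"
    unfolding h by (intro krig.span_sum krig.span_scale krig.span_base) simp
next
  assume "h \<in> krig.span (ctx_terms X S C)"
  then show "is_combination X S C h"
  proof (induction rule: krig.span_induct_alt)
    case base
    show ?case
      unfolding is_combination_def by (rule exI[of _ 0]) simp
  next
    case (step c x y)
    then obtain n :: nat and \<alpha> a s u where y: "\<forall>i<n. a i \<in> Mon X \<and> s i \<in> S \<and> u i \<in> Rig X \<and> C (a i) (s i) (u i)"
        "y = (\<Sum>i<n. scale (\<alpha> i) (ctx (a i) (s i) (u i)))"
      unfolding is_combination_def by blast
    from step obtain a' s' u' where x: "x = ctx a' s' u'" "a' \<in> Mon X" "s' \<in> S" "u' \<in> Rig X" "C a' s' u'"
      unfolding ctx_terms_def by blast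
    show ?case
      unfolding is_combination_def
      by (rule exI[of _ "Suc n"], rule exI[of _ "\<alpha>(n := c)"], rule exI[of _ "a(n := a')"],
          rule exI[of _ "s(n := s')"], rule exI[of _ "u(n := u')"])
         (use x y in \<open>auto simp: less_Suc_eq add.commute\<close>)
  qed
qed

lemma omega_ideal_subspace: "omega_ideal X I \<Longrightarrow> krig.subspace I"
  by (auto simp: omega_ideal_def krig.subspace_def)

lemma omega_ideal_ctx:
  assumes "omega_ideal X I" "f \<in> I" "a \<in> Mon X" "U \<in> Rig X"
  shows "ctx a f U \<in> I"
proof -
  have "basis_elem {#a#} \<in> kRig X" "basis_elem U \<in> kRig X"
    using assms by (auto simp: kRig_def Rig_def)
  then show ?thesis
    using assms unfolding ctx_def omega_ideal_def by (metis mult.commute)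
qed

lemma omega_ideal_span:
  assumes "omega_ideal X I" "S \<subseteq> I"
  shows "krig.span (ctx_terms X S C) \<subseteq> I"
  using assms
  by (intro krig.span_minimal omega_ideal_subspace) (auto simp: ctx_terms_def intro: omega_ideal_ctx)


section \<open>Monomial orderings\<close>

lemma rig_less_Rig: "monomial_ordering X r \<Longrightarrow> rig_less r v w \<Longrightarrow> v \<in> Rig X \<and> w \<in> Rig X"
  by (auto simp: monomial_ordering_def order_on_defs rig_less_def)

text \<open>
  Every context \<open>a \<cdot> _ \<circ> U\<close> is substitution into a monomial with a hole, so that the compatibility
  condition on monomial orderings applies to it.
\<close>

lemma rig_subst_star:
  "rig_subst (add_mset (add_mset None (image_mset Some a)) (image_mset (image_mset Some) U)) v
     = ctx_mon a v U"
proof -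
  have letters: "image_mset the {#l \<in># image_mset Some a. l \<noteq> None#} = a"
    "count (image_mset Some a) None = 0" for a :: "'a multiset"
    by (induction a) auto
  have singletons: "(\<Sum>x\<in>#U. {#x#}) = U"
    by (induction U) auto
  have comm: "rig_times v {#a#} = rig_times {#a#} v"
    by (induction v) (auto simp: rig_times_def add.commute)
  show ?thesis
    unfolding rig_subst_def ctx_mon_def
    by (simp add: letters image_mset.compositionality o_def singletons comm del: filter_mset_eq_conv not_None_eq)
qed

locale monomial_order =
  fixes X :: "'x set" and r :: "'x rig rel"
  assumes ordering: "monomial_ordering X r"
begin

abbreviation less (infix "\<prec>" 50) where "v \<prec> w \<equiv> rig_less r v w"

lemma less_trans: "u \<prec> v \<Longrightarrow> v \<prec> w \<Longrightarrow> u \<prec> w"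
  using ordering unfolding monomial_ordering_def order_on_defs rig_less_def
  by (metis antisymD transD)

lemma less_irrefl [simp]: "\<not> v \<prec> v"
  by (simp add: rig_less_def)

lemma less_asym: "v \<prec> w \<Longrightarrow> \<not> w \<prec> v"
  using less_trans less_irrefl by blast

lemma less_linear: "v \<in> Rig X \<Longrightarrow> w \<in> Rig X \<Longrightarrow> v \<prec> w \<or> v = w \<or> w \<prec> v"
  using ordering unfolding monomial_ordering_def order_on_defs rig_less_def total_on_def by blast

lemma wfp_less: "wfp (rig_less r)"
proof -
  have "wf (r - Id)"
    using ordering by (simp add: monomial_ordering_def well_order_on_def)
  moreover have "{(v, w). v \<prec> w} = r - Id"
    by (auto simp: rig_less_def)
  ultimately show ?thesis
    by (simp add: wfp_def)
qed

lemma less_le_iff: "w \<in> Rig X \<Longrightarrow> (v, w) \<in> r \<longleftrightarrow> v \<prec> w \<or> v = w"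
  using ordering unfolding monomial_ordering_def order_on_defs rig_less_def refl_on_def by blast

lemma ctx_mon_mono:
  assumes "v \<prec> w" "a \<in> Mon X" "U \<in> Rig X"
  shows "ctx_mon a v U \<prec> ctx_mon a w U"
proof -
  let ?u = "add_mset (add_mset None (image_mset Some a)) (image_mset (image_mset Some) U)"
  have [simp]: "count (image_mset Some a) None = 0" for a :: "'x multiset"
    by (induction a) auto
  have [simp]: "count (\<Sum>x\<in>#U. image_mset Some x) None = 0"
    by (induction U) auto
  have "?u \<in> star_monomials X"
    using assms by (auto simp: star_monomials_def Rig_def Mon_def subset_iff)
  then have "rig_subst ?u v \<prec> rig_subst ?u w"
    using ordering assms(1) rig_less_Rig[OF ordering assms(1)]
    unfolding monomial_ordering_def by blast
  then show ?thesis
    by (simp add: rig_subst_star)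
qed

text \<open>
  Otherwise iterating the strictly increasing map \<open>v \<mapsto> a v \<circ> U\<close> would give an infinite descent.
\<close>

lemma ctx_mon_not_less:
  assumes "a \<in> Mon X" "U \<in> Rig X"
  shows "\<not> ctx_mon a v U \<prec> v"
proof (induction v rule: wfp_induct_rule[OF wfp_less])
  case (1 v)
  then show ?case
    using ctx_mon_mono[OF _ assms] by blast
qed

lemma lead_eqI:
  assumes "w \<in> Rig X" "w \<in> Poly_Mapping.keys f"
    and "\<And>v. v \<in> Poly_Mapping.keys f \<Longrightarrow> v \<noteq> w \<Longrightarrow> v \<prec> w"
  shows "lead r f = w"
  unfolding lead_def
proof (rule the_equality)
  show "w \<in> Poly_Mapping.keys f \<and> (\<forall>v\<in>Poly_Mapping.keys f. (v, w) \<in> r)"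
    using assms less_le_iff by blast
  fix w'
  assume w': "w' \<in> Poly_Mapping.keys f \<and> (\<forall>v\<in>Poly_Mapping.keys f. (v, w') \<in> r)"
  then have "(w, w') \<in> r"
    using assms by blast
  then show "w' = w"
    using assms(3)[of w'] w' less_asym[of w w'] by (auto simp: rig_less_def)
qed

lemma finite_has_greatest:
  assumes "finite A" "A \<noteq> {}" "A \<subseteq> Rig X"
  shows "\<exists>w\<in>A. \<forall>v\<in>A. v \<noteq> w \<longrightarrow> v \<prec> w"
  using assms
proof (induction A rule: finite_ne_induct)
  case (insert x F)
  then obtain w where w: "w \<in> F" "\<forall>v\<in>F. v \<noteq> w \<longrightarrow> v \<prec> w"
    by auto
  then have "x \<prec> w \<or> x = w \<or> w \<prec> x"
    using insert less_linear by blast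
  then show ?case
    using w less_trans by (metis insert_iff)
qed auto

lemma
  assumes "f \<in> kRig X" "f \<noteq> 0"
  shows lead_in_keys: "lead r f \<in> Poly_Mapping.keys f"
    and less_lead: "\<And>v. v \<in> Poly_Mapping.keys f \<Longrightarrow> v \<noteq> lead r f \<Longrightarrow> v \<prec> lead r f"
    and lead_in_Rig: "lead r f \<in> Rig X"
proof -
  have f: "Poly_Mapping.keys f \<subseteq> Rig X" "Poly_Mapping.keys f \<noteq> {}"
    using assms by (auto simp: kRig_def)
  then obtain w where w: "w \<in> Poly_Mapping.keys f" "\<forall>v\<in>Poly_Mapping.keys f. v \<noteq> w \<longrightarrow> v \<prec> w"
    using finite_has_greatest[of "Poly_Mapping.keys f"] by auto
  then have "lead r f = w"
    using f by (intro lead_eqI) auto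
  then show "lead r f \<in> Poly_Mapping.keys f" "lead r f \<in> Rig X"
    "\<And>v. v \<in> Poly_Mapping.keys f \<Longrightarrow> v \<noteq> lead r f \<Longrightarrow> v \<prec> lead r f"
    using w f by auto
qed

lemma lead_ctx:
  assumes "f \<in> kRig X" "f \<noteq> 0" "a \<in> Mon X" "U \<in> Rig X"
  shows "lead r (ctx a f U) = ctx_mon a (lead r f) U"
  using lead_in_keys[OF assms(1,2)] less_lead[OF assms(1,2)] lead_in_Rig[OF assms(1,2)] assms
  by (intro lead_eqI) (auto simp: keys_ctx intro: ctx_mon_in_Rig ctx_mon_mono)

lemma monic_ctx:
  assumes "f \<in> kRig X" "monic r f" "a \<in> Mon X" "U \<in> Rig X"
  shows "monic r (ctx a f U)"
proof -
  have f: "f \<noteq> 0"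
    using assms by (simp add: monic_def)
  then have "ctx a f U \<noteq> 0"
    by (simp flip: keys_eq_empty add: keys_ctx)
  then show ?thesis
    using assms f by (simp add: monic_def lead_ctx)
qed

lemma lead_less_if_keys_less:
  assumes "f \<in> kRig X" "f \<noteq> 0" "\<And>v. v \<in> Poly_Mapping.keys f \<Longrightarrow> v \<prec> w"
  shows "lead r f \<prec> w"
  using assms lead_in_keys by blast

lemma cancel_lead_keys:
  assumes "f \<in> kRig X" "p \<in> kRig X" "monic r p" "f \<noteq> 0" "lead r p = lead r f"
    and "v \<in> Poly_Mapping.keys (f - scale (Poly_Mapping.lookup f (lead r f)) p)"
  shows "v \<prec> lead r f"
proof -
  have "v \<noteq> lead r f"
    using assms by (auto simp: in_keys_iff lookup_minus monic_def)
  moreover have "v \<in> Poly_Mapping.keys f \<or> v \<in> Poly_Mapping.keys p"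
    using assms(6) by (auto simp: in_keys_iff lookup_minus)
  ultimately show ?thesis
    using assms less_lead by (metis monic_def)
qed

end


section \<open>The Composition-Diamond lemma\<close>

text \<open>
  A common multiple of \<open>A\<close> and \<open>B\<close> with respect to \<open>\<circ>\<close> is their least one followed by some \<open>c\<close>,
  and the two cofactors split accordingly.
\<close>

lemma common_multiple_circ:
  assumes "A + U = B + (V :: 'a multiset)"
  shows "\<exists>c. U = (B - A) + c \<and> V = (A - B) + c"
proof (intro exI conjI)
  have "count A x + count U x = count B x + count V x" for x
    using assms by (metis count_union)
  note count = this
  show "U = (B - A) + (A + U - (A \<union># B))"
  proof (rule multiset_eqI)
    show "count U x = count ((B - A) + (A + U - (A \<union># B))) x" for x
      using count[of x] by (simp add: max_def)
  qed
  show "V = (A - B) + (A + U - (A \<union># B))"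
  proof (rule multiset_eqI)
    show "count V x = count ((A - B) + (A + U - (A \<union># B))) x" for x
      using count[of x] by (simp add: max_def)
  qed
qed

lemma lcm_circ_eq: "lcm_circ A B = A + (B - A)" "lcm_circ A B = B + (A - B)"
  by (rule multiset_eqI, simp add: lcm_circ_def min_def)+

lemma Rig_subset: "U \<subseteq># V \<Longrightarrow> V \<in> Rig X \<Longrightarrow> U \<in> Rig X"
  by (auto simp: Rig_def dest: mset_subset_eqD)

context monomial_order
begin

lemma add_less_mono: "v \<prec> w \<Longrightarrow> U \<in> Rig X \<Longrightarrow> v + U \<prec> w + U"
  using ctx_mon_mono[of v w "{#}" U] by (simp add: ctx_mon_eq multiset.map_ident_strong)

lemma keys_span_less:
  assumes "f \<in> krig.span T" "\<And>g v. g \<in> T \<Longrightarrow> v \<in> Poly_Mapping.keys g \<Longrightarrow> v \<prec> w"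
  shows "v \<in> Poly_Mapping.keys f \<Longrightarrow> v \<prec> w"
  using assms(1)
proof (induction arbitrary: v rule: krig.span_induct_alt)
  case (step c x y)
  then show ?case
    using assms(2) by (auto dest!: subsetD[OF keys_add] subsetD[OF keys_scale])
qed simp

text \<open>
  A linear combination has finitely many terms, hence a largest leading monomial \<open>lead r p\<close> among
  them. It may exceed \<open>lead r h\<close> because of cancellations.
\<close>

lemma span_lead_bounded:
  assumes "h \<in> krig.span A" "h \<noteq> 0" "\<And>g. g \<in> A \<Longrightarrow> lead r g \<in> Rig X"
  shows "\<exists>p\<in>A. h \<in> krig.span {g \<in> A. lead r g = lead r p \<or> lead r g \<prec> lead r p}"
proof -
  obtain t c where t: "finite t" "t \<subseteq> A" and h: "h = (\<Sum>g\<in>t. scale (c g) g)"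
    using assms(1) unfolding krig.span_explicit by blast
  have "t \<noteq> {}"
    using h assms(2) by auto
  moreover have "lead r ` t \<subseteq> Rig X"
    using t assms(3) by auto
  ultimately obtain p where p: "p \<in> t" "\<forall>g\<in>t. lead r g = lead r p \<or> lead r g \<prec> lead r p"
    using finite_has_greatest[of "lead r ` t"] t by auto
  have "h \<in> krig.span {g \<in> A. lead r g = lead r p \<or> lead r g \<prec> lead r p}"
    unfolding h using t p by (intro krig.span_sum krig.span_scale krig.span_base) auto
  then show ?thesis
    using p t by blast
qed

text \<open>
  An induction on a bound \<open>w\<close> for the leading monomials of the terms in a representation of \<open>h\<close>.
  By confluence all terms with leading monomial \<open>w\<close> can be replaced by multiples of a single one,
  \<open>p\<close>, at the expense of terms below \<open>w\<close>. If the total coefficient of \<open>p\<close> vanishes, then \<open>h\<close> has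
  a representation with a smaller bound; otherwise nothing cancels \<open>w\<close>, and it is the leading
  monomial of \<open>h\<close>.
\<close>

lemma lead_span_confluent:
  assumes G: "G \<subseteq> kRig X" "\<And>p. p \<in> G \<Longrightarrow> monic r p"
    and confluent: "\<And>p q. p \<in> G \<Longrightarrow> q \<in> G \<Longrightarrow> lead r p = lead r q \<Longrightarrow>
      p - q \<in> krig.span {g \<in> G. lead r g \<prec> lead r p}"
    and h: "h \<in> krig.span G" "h \<noteq> 0"
  shows "lead r h \<in> lead r ` G"
proof -
  have nz: "g \<noteq> 0" "g \<in> kRig X" if "g \<in> G" for g
    using G that by (auto simp: monic_def)
  have bounded: "lead r h \<in> lead r ` G"
    if "h \<in> krig.span {g \<in> G. lead r g = w \<or> lead r g \<prec> w}" "h \<noteq> 0" for h w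
    using that
  proof (induction w arbitrary: h rule: wfp_induct_rule[OF wfp_less])
    case (1 w)
    let ?G = "{g \<in> G. lead r g \<prec> w}"
    have below: "lead r h \<in> lead r ` G" if h: "h \<in> krig.span ?G" "h \<noteq> 0" for h
    proof -
      obtain p where p: "p \<in> ?G"
        "h \<in> krig.span {g \<in> ?G. lead r g = lead r p \<or> lead r g \<prec> lead r p}"
        using span_lead_bounded[OF h] lead_in_Rig nz by blast
      then have "h \<in> krig.span {g \<in> G. lead r g = lead r p \<or> lead r g \<prec> lead r p}"
        by (elim subsetD[OF krig.span_mono, rotated]) auto
      then show ?thesis
        using 1(1)[of "lead r p" h] p h(2) by blast
    qed
    show ?case
    proof (cases "\<exists>p\<in>G. lead r p = w")
      case False
      then have "{g \<in> G. lead r g = w \<or> lead r g \<prec> w} = ?G"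
        by auto
      then show ?thesis
        using below[of h] 1(2,3) by simp
    next
      case True
      then obtain p where p: "p \<in> G" "lead r p = w"
        by blast
      have "{g \<in> G. lead r g = w \<or> lead r g \<prec> w} \<subseteq> krig.span (insert p ?G)"
      proof
        fix g
        assume g: "g \<in> {g \<in> G. lead r g = w \<or> lead r g \<prec> w}"
        show "g \<in> krig.span (insert p ?G)"
        proof (cases "lead r g = w")
          case True
          then have "g - scale 1 p \<in> krig.span ?G"
            using confluent[of g p] p g by auto
          then show ?thesis
            using krig.span_breakdown_eq by blast
        next
          case False
          then show ?thesis
            using g by (intro krig.span_base) auto
        qed
      qed
      then have "h \<in> krig.span (insert p ?G)"
        using 1(2) krig.span_minimal krig.subspace_span by blast
      then obtain c where c: "h - scale c p \<in> krig.span ?G"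
        using krig.span_breakdown_eq by blast
      show ?thesis
      proof (cases "c = 0")
        case True
        then show ?thesis
          using below c 1(3) by simp
      next
        case False
        have small: "v \<prec> w" if v: "v \<in> Poly_Mapping.keys (h - scale c p)" for v
        proof (rule keys_span_less[OF c _ v])
          show "v \<prec> w" if "g \<in> ?G" "v \<in> Poly_Mapping.keys g" for g v
            using that nz[of g] less_lead[of g v] less_trans by blast
        qed
        have "w \<notin> Poly_Mapping.keys (h - scale c p)"
          using small[of w] by auto
        then have "Poly_Mapping.lookup h w = c"
          using G(2)[OF p(1)] p(2) by (simp add: in_keys_iff lookup_minus monic_def)
        moreover have "v \<prec> w" if "v \<in> Poly_Mapping.keys h" "v \<noteq> w" for v
        proof (cases "v \<in> Poly_Mapping.keys p")
          case True
          then show ?thesis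
            using less_lead[of p v] nz[of p] p that(2) by auto
        next
          case False
          then have "v \<in> Poly_Mapping.keys (h - scale c p)"
            using that(1) by (simp add: in_keys_iff lookup_minus)
          then show ?thesis
            by (rule small)
        qed
        ultimately have "lead r h = w"
          using False lead_in_Rig[of p] nz[OF p(1)] p(2) by (intro lead_eqI) (auto simp: in_keys_iff)
        then show ?thesis
          using p by (metis imageI)
      qed
    qed
  qed
  have "lead r g \<in> Rig X" if "g \<in> G" for g
    using lead_in_Rig[of g] nz[OF that] by simp
  then obtain p where "p \<in> G" and
      "h \<in> krig.span {g \<in> G. lead r g = lead r p \<or> lead r g \<prec> lead r p}"
    using span_lead_bounded[OF h] by blast
  then show ?thesis
    using bounded h(2) by blast
qed

abbreviation terms_below :: "('x, 'k::field) krig set \<Rightarrow> 'x rig \<Rightarrow> ('x, 'k) krig set"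
  where "terms_below S w \<equiv> ctx_terms X S (\<lambda>a s u. ctx_mon a (lead r s) u \<prec> w)"

lemma trivial_mod_iff_span: "trivial_mod X r S w h \<longleftrightarrow> h \<in> krig.span (terms_below S w)"
  by (simp add: trivial_mod_def is_combination_iff_span)

lemma ctx_span_terms_below:
  assumes "h \<in> krig.span (terms_below S w)" "e \<in> Mon X" "c \<in> Rig X"
  shows "ctx e h c \<in> krig.span (terms_below S (ctx_mon e w c))"
  using assms(1)
proof (induction rule: krig.span_induct_alt)
  case base
  show ?case
    by (simp add: ctx_zero krig.span_zero)
next
  case (step k x y)
  then obtain a s u where x: "x = ctx a s u" "a \<in> Mon X" "s \<in> S" "u \<in> Rig X" "ctx_mon a (lead r s) u \<prec> w"
    unfolding ctx_terms_def by blast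
  have "ctx_mon (e + a) (lead r s) (ctx_mon e u c) \<prec> ctx_mon e w c"
    using ctx_mon_mono[OF x(5) assms(2,3)] by (simp add: ctx_mon_ctx_mon)
  then have "ctx e x c \<in> terms_below S (ctx_mon e w c)"
    unfolding x(1) ctx_ctx using x(2-4) assms(2,3)
    by (intro ctx_termsI) (auto intro: ctx_mon_in_Rig)
  then show ?case
    unfolding ctx_add ctx_scale
    by (intro krig.span_add krig.span_scale) (auto intro: krig.span_base step.IH)
qed

lemma tail_mult_ctx:
  assumes S: "g \<in> S" and p: "p \<in> kRig X" "monic r p"
    and "b \<in> Mon X" "c \<in> Rig X" "g \<in> kRig X" "g \<noteq> 0"
  shows "(p - basis_elem (lead r p)) * ctx b g c \<in>
    krig.span (terms_below S (lead r p + ctx_mon b (lead r g) c))"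
  unfolding mult_ctx
proof (intro krig.span_sum krig.span_scale krig.span_base)
  fix v
  assume v: "v \<in> Poly_Mapping.keys (p - basis_elem (lead r p))"
  have "v \<noteq> lead r p"
    using v p by (auto simp: in_keys_iff lookup_minus monic_def)
  moreover have "v \<in> Poly_Mapping.keys p"
    using v calculation by (auto simp: in_keys_iff lookup_minus lookup_single)
  ultimately have v: "v \<prec> lead r p" "v \<in> Rig X"
    using less_lead p by (auto simp: monic_def kRig_def)
  have "v + ctx_mon b (lead r g) c \<prec> lead r p + ctx_mon b (lead r g) c"
    using assms v lead_in_Rig by (intro add_less_mono ctx_mon_in_Rig)
  then show "ctx b g (c + v) \<in> terms_below S (lead r p + ctx_mon b (lead r g) c)"
    using assms v by (intro ctx_termsI) (auto simp: ctx_mon_eq ac_simps)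
qed

text \<open>
  The leading parts \<open>F\<close> of \<open>p = a f\<close> and \<open>H\<close> of \<open>q = b g\<close> stand side by side in \<open>F \<circ> H \<circ> c\<close>.
  Since \<open>p \<circ> q\<close> reduces in both ways, \<open>p \<circ> H - F \<circ> q = (p - F) \<circ> q - (q - H) \<circ> p\<close>, and the tails
  \<open>p - F\<close> and \<open>q - H\<close> only have monomials below \<open>F\<close> and \<open>H\<close>.
\<close>

lemma disjoint_ctx_diff:
  fixes S :: "('x, 'k::field) krig set"
  assumes S: "S \<subseteq> kRig X" "\<And>s. s \<in> S \<Longrightarrow> monic r s" and fg: "f \<in> S" "g \<in> S"
    and ab: "a \<in> Mon X" "b \<in> Mon X" and c: "c \<in> Rig X"
    and F: "F = ctx_mon a (lead r f) {#}" and H: "H = ctx_mon b (lead r g) {#}"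
  shows "ctx a f (H + c) - ctx b g (F + c) \<in> krig.span (terms_below S (F + H + c))"
proof -
  let ?p = "ctx a f {#}" and ?q = "ctx b g {#}"
  have nz: "f \<in> kRig X" "g \<in> kRig X" "monic r f" "monic r g" "f \<noteq> 0" "g \<noteq> 0"
    using S fg by (auto simp: monic_def)
  have pq: "?p \<in> kRig X" "?q \<in> kRig X" "monic r ?p" "monic r ?q" "lead r ?p = F" "lead r ?q = H"
    using nz ab by (auto simp: ctx_in_kRig monic_ctx lead_ctx F H)
  have shift: "ctx a f U = basis_elem U * ?p" "ctx b g U = basis_elem U * ?q" for U
    by (simp_all add: single_mult_ctx)
  have basis: "basis_elem (V + c) = basis_elem V * (basis_elem c :: ('x, 'k) krig)" for V
    by (simp add: mult_single)
  have "ctx a f (H + c) - ctx b g (F + c) =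
      (?p - basis_elem F) * ctx b g c - (?q - basis_elem H) * ctx a f c"
    unfolding shift[of "_ + c"] shift[of c] basis by (simp add: algebra_simps)
  moreover have "(?p - basis_elem F) * ctx b g c \<in> krig.span (terms_below S (F + H + c))"
    using tail_mult_ctx[of g S ?p b c] nz pq fg ab c by (simp add: H ctx_mon_eq ac_simps)
  moreover have "(?q - basis_elem H) * ctx a f c \<in> krig.span (terms_below S (F + H + c))"
    using tail_mult_ctx[of f S ?q a c] nz pq fg ab c by (simp add: F ctx_mon_eq ac_simps)
  ultimately show ?thesis
    by (simp add: krig.span_diff)
qed

text \<open>
  Write \<open>F\<close> and \<open>H\<close> for \<open>a\<close> and \<open>b\<close> times the leading monomials of \<open>f\<close> and \<open>g\<close>. If \<open>F\<close> and \<open>H\<close>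
  have no summand in common, the tails of \<open>f\<close> and \<open>g\<close> suffice. A common summand has the form
  \<open>a u = b v\<close>, so it is a multiple \<open>e lcm(u,v)\<close>; the composition belonging to the pair \<open>(u,v)\<close>,
  multiplied by \<open>e\<close> and followed by what \<open>F\<close> and \<open>H\<close> leave of \<open>w\<close>, is the given difference.
\<close>

lemma GS_basis_confluent:
  assumes GS: "GS_basis X r S" and fg: "f \<in> S" "g \<in> S"
    and ab: "a \<in> Mon X" "b \<in> Mon X" and UV: "U \<in> Rig X" "V \<in> Rig X"
    and w: "ctx_mon a (lead r f) U = w" "ctx_mon b (lead r g) V = w"
  shows "ctx a f U - ctx b g V \<in> krig.span (terms_below S w)"
proof -
  define F where "F = ctx_mon a (lead r f) {#}"
  define H where "H = ctx_mon b (lead r g) {#}"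
  have wFH: "w = F + U" "w = H + V"
    using w by (auto simp: F_def H_def ctx_mon_eq)
  then obtain c where c: "U = (H - F) + c" "V = (F - H) + c"
    using common_multiple_circ[of F U H V] by auto
  have cR: "c \<in> Rig X"
    using UV c by simp
  show ?thesis
  proof (cases "F \<inter># H = {#}")
    case True
    then have "H - F = H" "F - H = F"
      by (metis diff_intersect_left_idem diff_empty inter_mset_def multiset_inter_commute)+
    then show ?thesis
      using disjoint_ctx_diff[of S f g a b c F H] GS fg ab cR c wFH
      by (auto simp: GS_basis_def F_def H_def ac_simps)
  next
    case False
    then obtain x where "x \<in># F" "x \<in># H"
      by (metis multiset_nonemptyE inter_iff)
    then obtain u v where u: "u \<in># lead r f" "x = a + u" and v: "v \<in># lead r g" "x = b + v"
      by (auto simp: F_def H_def ctx_mon_eq)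
    define m where "m = u \<union># v"
    define e where "e = x - m"
    define a0 where "a0 = m - u"
    define b0 where "b0 = m - v"
    have "u \<subseteq># x" "v \<subseteq># x"
      unfolding u(2) by (simp, unfold u(2)[symmetric] v(2)) simp
    then have sub: "u \<subseteq># m" "v \<subseteq># m" "m \<subseteq># x"
      by (auto simp: m_def)
    have "a + u = e + m" "b + v = e + m"
      using u v sub by (auto simp: e_def)
    moreover have m: "a0 + u = m" "b0 + v = m"
      using sub by (auto simp: a0_def b0_def)
    ultimately have a: "a = e + a0" and b: "b = e + b0"
      by (metis add_right_cancel add.assoc)+
    define A where "A = ctx_mon a0 (lead r f) {#}"
    define B where "B = ctx_mon b0 (lead r g) {#}"
    have FA: "F = ctx_mon e A {#}" and HB: "H = ctx_mon e B {#}"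
      unfolding F_def H_def A_def B_def a b ctx_mon_ctx_mon by (simp_all add: ctx_mon_eq)
    \<comment> \<open>The common factor \<open>e\<close> passes through \<open>lcm\<^sub>\<circ>\<close>, as multiplication by \<open>e\<close> is injective on \<open>[X]\<close>.\<close>
    have "inj ((+) e)"
      by (rule injI) simp
    then have U: "U = ctx_mon e (B - A) c" and V: "V = ctx_mon e (A - B) c"
      by (simp_all add: c FA HB ctx_mon_eq image_mset_diff_if_inj)
    let ?h = "ctx a0 f (B - A) - ctx b0 g (A - B)"
    have "is_composition r f g (lcm_circ A B) ?h"
      unfolding is_composition_def
      by (rule exI[of _ u], rule exI[of _ v], rule exI[of _ a0], rule exI[of _ b0],
          rule exI[of _ "B - A"], rule exI[of _ "A - B"])
        (use u v m in \<open>simp add: m_def lcm_circ_eq(1)[of A B] A_def B_def ctx_mon_eq rig_times_def\<close>,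
         metis lcm_circ_eq)
    then have "?h \<in> krig.span (terms_below S (lcm_circ A B))"
      using GS fg by (auto simp: GS_basis_def trivial_mod_iff_span)
    then have "ctx e ?h c \<in> krig.span (terms_below S (ctx_mon e (lcm_circ A B) c))"
      using ab cR by (intro ctx_span_terms_below) (auto simp: a)
    moreover have "ctx e ?h c = ctx a f U - ctx b g V"
      by (simp add: ctx_diff ctx_ctx a b U V)
    moreover have "ctx_mon e (lcm_circ A B) c = w"
      by (simp add: wFH(1) U FA lcm_circ_eq(1) ctx_mon_eq)
    ultimately show ?thesis
      by simp
  qed
qed

text \<open>
  The leading monomials of the terms \<open>a s \<circ> u\<close> are exactly the multiples of the leading monomials of
  \<open>S\<close>, and the Groebner-Shirshov property makes these terms confluent.
\<close>

lemma composition_diamond: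
  assumes GS: "GS_basis X r S" and h: "is_combination X S (\<lambda>_ _ _. True) h" "h \<noteq> 0"
  shows "\<exists>a\<in>Mon X. \<exists>u\<in>Rig X. \<exists>s\<in>S. lead r h = ctx_mon a (lead r s) u"
proof -
  let ?G = "ctx_terms X S (\<lambda>_ _ _. True)"
  have S: "S \<subseteq> kRig X" "\<And>s. s \<in> S \<Longrightarrow> monic r s" "\<And>s. s \<in> S \<Longrightarrow> s \<noteq> 0"
    using GS by (auto simp: GS_basis_def monic_def)
  have lead: "lead r (ctx a s u) = ctx_mon a (lead r s) u"
    if "a \<in> Mon X" "s \<in> S" "u \<in> Rig X" for a s u
    using that S by (intro lead_ctx) auto
  have "lead r h \<in> lead r ` ?G"
  proof (rule lead_span_confluent)
    show "?G \<subseteq> kRig X" "\<And>p. p \<in> ?G \<Longrightarrow> monic r p"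
      using S by (auto simp: ctx_terms_def intro!: ctx_in_kRig monic_ctx)
    show "h \<in> krig.span ?G" "h \<noteq> 0"
      using h by (auto simp: is_combination_iff_span)
    fix p q
    assume "p \<in> ?G" "q \<in> ?G" and pq: "lead r p = lead r q"
    then obtain a f U b g V where *: "p = ctx a f U" "q = ctx b g V" "a \<in> Mon X" "b \<in> Mon X"
        "f \<in> S" "g \<in> S" "U \<in> Rig X" "V \<in> Rig X"
      by (auto simp: ctx_terms_def)
    have "p - q \<in> krig.span (terms_below S (lead r p))"
      unfolding *(1,2) using * pq by (intro GS_basis_confluent[OF GS]) (simp_all add: lead)
    moreover have "terms_below S (lead r p) \<subseteq> {g \<in> ?G. lead r g \<prec> lead r p}"
      by (auto simp: ctx_terms_def lead)
    ultimately show "p - q \<in> krig.span {g \<in> ?G. lead r g \<prec> lead r p}"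
      using krig.span_mono by blast
  qed
  then obtain a s u where "lead r h = ctx_mon a (lead r s) u" "a \<in> Mon X" "s \<in> S" "u \<in> Rig X"
    by (auto simp: ctx_terms_def lead)
  then show ?thesis
    by blast
qed

end


section \<open>Leading monomials of an ideal and the reduced basis\<close>

definition multiples :: "'x set \<Rightarrow> 'x rig set \<Rightarrow> 'x rig set"
  where "multiples X M = {ctx_mon a m U | a m U. a \<in> Mon X \<and> m \<in> M \<and> U \<in> Rig X}"

definition minimal_monomials :: "'x set \<Rightarrow> 'x rig set \<Rightarrow> 'x rig set"
  where "minimal_monomials X L = {m \<in> L. \<forall>m'\<in>L. m \<in> multiples X {m'} \<longrightarrow> m' = m}"

definition lead_set :: "'x rig rel \<Rightarrow> ('x, 'k::field) krig set \<Rightarrow> 'x rig set"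
  where "lead_set r I = lead r ` (I - {0})"

definition reduced_elements :: "'x set \<Rightarrow> 'x rig rel \<Rightarrow> ('x, 'k::field) krig set \<Rightarrow> ('x, 'k) krig set"
  where "reduced_elements X r I =
    {s \<in> I. monic r s \<and> lead r s \<in> minimal_monomials X (lead_set r I) \<and>
       (\<forall>v\<in>Poly_Mapping.keys s - {lead r s}. v \<notin> lead_set r I)}"

lemma Irr_eq: "Irr X r S = Rig X - multiples X (lead r ` S)"
  by (auto simp: Irr_def multiples_def)

lemma multiplesI: "a \<in> Mon X \<Longrightarrow> m \<in> M \<Longrightarrow> U \<in> Rig X \<Longrightarrow> ctx_mon a m U \<in> multiples X M"
  unfolding multiples_def by blast

lemma multiplesE:
  assumes "w \<in> multiples X M"
  obtains a m U where "w = ctx_mon a m U" "a \<in> Mon X" "m \<in> M" "U \<in> Rig X"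
  using assms unfolding multiples_def by blast

lemma multiples_self: "m \<in> M \<Longrightarrow> m \<in> multiples X M"
  using multiplesI[of "{#}" X m M "{#}"] by simp

lemma multiples_mono: "M \<subseteq> N \<Longrightarrow> multiples X M \<subseteq> multiples X N"
  unfolding multiples_def by blast

lemma multiples_of_one: "w \<in> multiples X M \<Longrightarrow> \<exists>m\<in>M. w \<in> multiples X {m}"
  unfolding multiples_def by blast

lemma multiples_trans:
  assumes "w \<in> multiples X {v}" "v \<in> multiples X M"
  shows "w \<in> multiples X M"
proof -
  obtain c W where w: "w = ctx_mon c v W" "c \<in> Mon X" "W \<in> Rig X"
    using assms(1) by (auto elim: multiplesE)
  obtain a m U where v: "v = ctx_mon a m U" "a \<in> Mon X" "m \<in> M" "U \<in> Rig X"
    using assms(2) by (rule multiplesE)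
  show ?thesis
    unfolding w(1) v(1) ctx_mon_ctx_mon using v w by (intro multiplesI ctx_mon_in_Rig) auto
qed

context monomial_order
begin

lemma multiples_not_less: "w \<in> multiples X {m} \<Longrightarrow> \<not> w \<prec> m"
  by (auto elim!: multiplesE dest: ctx_mon_not_less)

text \<open>
  A proper divisor inside \<open>L\<close> of a monomial is smaller in the well-ordering, so passing to proper
  divisors ends at a minimal element.
\<close>

lemma multiple_of_minimal_monomial:
  assumes "L \<subseteq> Rig X" "w \<in> L"
  shows "w \<in> multiples X (minimal_monomials X L)"
  using assms(2)
proof (induction w rule: wfp_induct_rule[OF wfp_less])
  case (1 w)
  show ?case
  proof (cases "w \<in> minimal_monomials X L")
    case True
    then show ?thesis
      by (rule multiples_self)
  next
    case False
    then obtain m where m: "m \<in> L" "w \<in> multiples X {m}" "m \<noteq> w"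
      using 1(2) by (auto simp: minimal_monomials_def)
    then have "m \<prec> w"
      using less_linear[of m w] multiples_not_less[of w m] assms(1) 1(2) by blast
    then show ?thesis
      using 1(1) m multiples_trans by blast
  qed
qed

end

locale krig_ideal = monomial_order X r for X :: "'x set" and r +
  fixes I :: "('x, 'k::field) krig set"
  assumes ideal: "omega_ideal X I"
begin

lemma ideal_subset: "I \<subseteq> kRig X"
  using ideal by (simp add: omega_ideal_def)

lemma ideal_nonzero: "f \<in> I \<Longrightarrow> f \<noteq> 0 \<Longrightarrow> lead r f \<in> lead_set r I"
  by (simp add: lead_set_def)

lemma lead_set_subset: "lead_set r I \<subseteq> Rig X"
  using ideal_subset lead_in_Rig by (auto simp: lead_set_def)

lemmas subspace = omega_ideal_subspace[OF ideal]

lemma multiples_lead_set: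
  assumes "w \<in> multiples X (lead_set r I)"
  shows "w \<in> lead_set r I"
proof -
  obtain a f U where w: "w = ctx_mon a (lead r f) U" "a \<in> Mon X" "U \<in> Rig X" "f \<in> I" "f \<noteq> 0"
    using assms by (auto simp: lead_set_def elim!: multiplesE)
  then have "ctx a f U \<in> I" "ctx a f U \<noteq> 0"
    using omega_ideal_ctx[OF ideal] by (simp_all flip: keys_eq_empty add: keys_ctx)
  then show ?thesis
    using ideal_nonzero[of "ctx a f U"] lead_ctx[of f a U] w ideal_subset by auto
qed

text \<open>
  The difference \<open>s - t\<close> loses the common leading monomial, and the remaining monomials are not
  leading monomials of elements of \<open>I\<close>. A nonzero element of \<open>I\<close> cannot be of this kind.
\<close>

lemma reduced_elements_unique:
  assumes s: "s \<in> reduced_elements X r I" and t: "t \<in> reduced_elements X r I"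
    and eq: "lead r s = lead r t"
  shows "s = t"
proof (rule ccontr)
  assume "s \<noteq> t"
  have "s - t \<in> I"
    using s t krig.subspace_diff[OF subspace] by (auto simp: reduced_elements_def)
  then have *: "lead r (s - t) \<in> lead_set r I" "lead r (s - t) \<in> Poly_Mapping.keys (s - t)"
    using \<open>s \<noteq> t\<close> ideal_nonzero[of "s - t"] lead_in_keys[of "s - t"] ideal_subset by auto
  then have "lead r (s - t) \<noteq> lead r s"
    using s t eq by (auto simp: in_keys_iff lookup_minus reduced_elements_def monic_def)
  moreover have "lead r (s - t) \<in> Poly_Mapping.keys s \<or> lead r (s - t) \<in> Poly_Mapping.keys t"
    using *(2) by (auto simp: in_keys_iff lookup_minus)
  ultimately show False
    using * s t eq by (auto simp: reduced_elements_def)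
qed

lemma lead_set_eq_multiples:
  assumes "GS_basis_for X r S I"
  shows "lead_set r I = multiples X (lead r ` S)"
proof
  have GS: "GS_basis X r S" and comb: "\<And>h. h \<in> I \<Longrightarrow> is_combination X S (\<lambda>_ _ _. True) h"
    and SI: "S \<subseteq> I"
    using assms hull_subset[of S "omega_ideal X"] by (auto simp: GS_basis_for_def Id_gen_def)
  show "lead_set r I \<subseteq> multiples X (lead r ` S)"
  proof
    fix w
    assume "w \<in> lead_set r I"
    then obtain h where h: "h \<in> I" "h \<noteq> 0" "w = lead r h"
      by (auto simp: lead_set_def)
    then obtain a u s where "a \<in> Mon X" "u \<in> Rig X" "s \<in> S" "w = ctx_mon a (lead r s) u"
      using composition_diamond[OF GS comb] by metis
    then show "w \<in> multiples X (lead r ` S)"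
      by (auto intro: multiplesI)
  qed
  have "lead r ` S \<subseteq> lead_set r I"
    using SI GS by (auto simp: lead_set_def GS_basis_def monic_def)
  then show "multiples X (lead r ` S) \<subseteq> lead_set r I"
    using multiples_mono multiples_lead_set by blast
qed

text \<open>
  For \<open>s\<close> in \<open>S\<close>, any monomial of \<open>s\<close> that lies in \<^const>\<open>lead_set\<close> is a multiple of the
  leading monomial of some element of \<open>S\<close>, and this element can only be \<open>s\<close> itself, because \<open>S\<close>
  is reduced. Hence such a monomial is not below the leading monomial of \<open>s\<close>, which leaves only
  the leading monomial itself; for the same reason that one is minimal.
\<close>

lemma reduced_basis_eq:
  assumes "reduced_GS_basis_for X r S I"
  shows "S = reduced_elements X r I"
proof -
  have basis: "GS_basis_for X r S I" and SI: "S \<subseteq> I"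
    and irr: "\<And>s. s \<in> S \<Longrightarrow> Poly_Mapping.keys s \<subseteq> Irr X r (S - {s})"
    and monic: "\<And>s. s \<in> S \<Longrightarrow> monic r s"
    using assms hull_subset[of S "omega_ideal X"]
    by (auto simp: reduced_GS_basis_for_def GS_basis_for_def GS_basis_def Id_gen_def)
  note lead_set = lead_set_eq_multiples[OF basis]
  have nz: "s \<noteq> 0" "s \<in> kRig X" if "s \<in> S" for s
    using that monic SI ideal_subset by (auto simp: monic_def)
  have only_self: "v \<in> multiples X {lead r s}" if sv: "s \<in> S" "v \<in> Poly_Mapping.keys s" "v \<in> lead_set r I" for s v
  proof -
    obtain a t U where v: "v = ctx_mon a (lead r t) U" "a \<in> Mon X" "t \<in> S" "U \<in> Rig X"
      using sv(3) by (auto simp: lead_set elim!: multiplesE)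
    have "t = s"
      using irr[OF sv(1)] sv(2) v by (auto simp: Irr_eq intro: multiplesI)
    then show ?thesis
      using v by (auto intro: multiplesI)
  qed
  have SR: "S \<subseteq> reduced_elements X r I"
  proof
    fix s
    assume s: "s \<in> S"
    have "lead r s = m" if m: "m \<in> lead_set r I" "lead r s \<in> multiples X {m}" for m
    proof -
      obtain a t U where t: "m = ctx_mon a (lead r t) U" "a \<in> Mon X" "t \<in> S" "U \<in> Rig X"
        using m(1) by (auto simp: lead_set elim!: multiplesE)
      then have "lead r s \<in> multiples X {lead r t}"
        using m(2) by (auto intro: multiples_trans multiplesI)
      then have "t = s"
        using irr[OF s] lead_in_keys[of s] nz[OF s] t(3) multiples_mono[of "{lead r t}" "lead r ` (S - {s})" X]
        by (auto simp: Irr_eq)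
      then have "m \<in> multiples X {lead r s}"
        using t by (auto intro: multiplesI)
      then show ?thesis
        using multiples_not_less m lead_set_subset less_linear[of m "lead r s"] lead_in_Rig[of s] nz[OF s]
        by blast
    qed
    then have "lead r s \<in> minimal_monomials X (lead_set r I)"
      using ideal_nonzero[of s] nz[OF s] s SI by (auto simp: minimal_monomials_def)
    moreover have "v \<notin> lead_set r I" if "v \<in> Poly_Mapping.keys s - {lead r s}" for v
      using that only_self[of s v] multiples_not_less[of v "lead r s"] less_lead[of s v] nz[OF s] s by auto
    ultimately show "s \<in> reduced_elements X r I"
      using s SI monic by (auto simp: reduced_elements_def)
  qed
  moreover have "s \<in> S" if s: "s \<in> reduced_elements X r I" for s
  proof -
    have m: "lead r s \<in> minimal_monomials X (lead_set r I)"
      using s by (simp add: reduced_elements_def)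
    then have "lead r s \<in> multiples X (lead r ` S)"
      by (simp add: minimal_monomials_def lead_set)
    then obtain t where t: "t \<in> S" "lead r s \<in> multiples X {lead r t}"
      using multiples_of_one by blast
    then have "lead r t = lead r s"
      using m ideal_nonzero[of t] nz[of t] SI by (auto simp: minimal_monomials_def)
    then show ?thesis
      using reduced_elements_unique[of t s] SR t s by auto
  qed
  ultimately show ?thesis
    by blast
qed

text \<open>
  The normal form of a monomial: if \<open>w\<close> is the leading monomial of a monic \<open>f\<close> in \<open>I\<close>, replace it
  by the negative of the tail of \<open>f\<close>, whose monomials are smaller and have normal forms already.
\<close>

lemma reduce_monomial:
  assumes "w \<in> Rig X"
  shows "\<exists>n. basis_elem w - n \<in> I \<and>
    (\<forall>v\<in>Poly_Mapping.keys n. v \<in> Rig X \<and> v \<notin> lead_set r I \<and> (v = w \<or> v \<prec> w))"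
  using assms
proof (induction w rule: wfp_induct_rule[OF wfp_less])
  case (1 w)
  show ?case
  proof (cases "w \<in> lead_set r I")
    case False
    then show ?thesis
      using 1(2) krig.subspace_0[OF subspace] by (intro exI[of _ "basis_elem w"]) auto
  next
    case True
    then obtain g where g: "g \<in> I" "g \<noteq> 0" "w = lead r g"
      by (auto simp: lead_set_def)
    define d where "d = Poly_Mapping.lookup g w"
    have "d \<noteq> 0"
      using lead_in_keys[of g] g ideal_subset by (auto simp: d_def in_keys_iff)
    define f where "f = scale (1 / d) g"
    have fI: "f \<in> I" and fw: "Poly_Mapping.lookup f w = 1"
      using g \<open>d \<noteq> 0\<close> krig.subspace_scale[OF subspace] by (auto simp: f_def d_def)
    let ?K = "Poly_Mapping.keys f - {w}"
    have K: "v \<prec> w" "v \<in> Rig X" if "v \<in> ?K" for v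
      using that less_lead[of g v] g ideal_subset keys_scale[of "1 / d" g]
      by (auto simp: f_def kRig_def)
    then have "\<exists>n. basis_elem v - n \<in> I \<and>
        (\<forall>u\<in>Poly_Mapping.keys n. u \<in> Rig X \<and> u \<notin> lead_set r I \<and> (u = v \<or> u \<prec> v))" if "v \<in> ?K" for v
      using 1(1) that by blast
    then obtain n where n: "\<And>v. v \<in> ?K \<Longrightarrow> basis_elem v - n v \<in> I"
      "\<And>v u. v \<in> ?K \<Longrightarrow> u \<in> Poly_Mapping.keys (n v) \<Longrightarrow>
        u \<in> Rig X \<and> u \<notin> lead_set r I \<and> (u = v \<or> u \<prec> v)"
      by metis
    let ?c = "Poly_Mapping.lookup f"
    let ?n = "- (\<Sum>v\<in>?K. scale (?c v) (n v))"
    have "w \<in> Poly_Mapping.keys f"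
      using fw by (simp add: in_keys_iff)
    then have "f = basis_elem w + (\<Sum>v\<in>?K. scale (?c v) (basis_elem v))"
      using krig_sum_monomials[of f] fw by (simp add: sum.remove)
    then have "basis_elem w = f - (\<Sum>v\<in>?K. scale (?c v) (basis_elem v))"
      by (rule iffD2[OF eq_diff_eq, OF sym])
    then have eq: "basis_elem w - ?n = f - (\<Sum>v\<in>?K. scale (?c v) (basis_elem v - n v))"
      by (simp only: krig.scale_right_diff_distrib sum_subtractf) simp
    have "basis_elem w - ?n \<in> I"
      unfolding eq by (intro krig.subspace_diff[OF subspace] fI krig.subspace_sum[OF subspace]
          krig.subspace_scale[OF subspace] n(1))
    moreover have "u \<in> Rig X \<and> u \<notin> lead_set r I \<and> (u = w \<or> u \<prec> w)" if u: "u \<in> Poly_Mapping.keys ?n" for u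
    proof -
      obtain v where v: "v \<in> ?K" "u \<in> Poly_Mapping.keys (scale (?c v) (n v))"
        using u subsetD[OF keys_sum] by fastforce
      then have "u \<in> Poly_Mapping.keys (n v)"
        using keys_scale by blast
      then show ?thesis
        using n(2)[OF v(1)] K[OF v(1)] less_trans by blast
    qed
    ultimately show ?thesis
      by blast
  qed
qed

text \<open>
  The element is \<open>m\<close> minus its normal form modulo \<open>I\<close>.
\<close>

lemma ex_reduced_element:
  assumes m: "m \<in> minimal_monomials X (lead_set r I)"
  shows "\<exists>s\<in>reduced_elements X r I. lead r s = m"
proof -
  have mL: "m \<in> lead_set r I" "m \<in> Rig X"
    using m lead_set_subset by (auto simp: minimal_monomials_def)
  then obtain n where n: "basis_elem m - n \<in> I"
    "\<And>v. v \<in> Poly_Mapping.keys n \<Longrightarrow> v \<notin> lead_set r I \<and> (v = m \<or> v \<prec> m)"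
    using reduce_monomial[of m] by blast
  let ?s = "basis_elem m - n"
  have "m \<notin> Poly_Mapping.keys n"
    using n(2) mL by blast
  then have sm: "Poly_Mapping.lookup ?s m = 1"
    by (simp add: lookup_minus in_keys_iff)
  have keys: "v \<in> Poly_Mapping.keys n" if "v \<in> Poly_Mapping.keys ?s" "v \<noteq> m" for v
    using that by (auto simp: lookup_minus in_keys_iff lookup_single)
  have lead: "lead r ?s = m"
  proof (rule lead_eqI)
    show "m \<in> Poly_Mapping.keys ?s"
      using sm by (simp add: in_keys_iff)
    show "v \<prec> m" if "v \<in> Poly_Mapping.keys ?s" "v \<noteq> m" for v
      using keys[OF that] n(2) that(2) by blast
  qed (rule mL)
  moreover have "?s \<noteq> 0"
    using sm by (metis lookup_zero zero_neq_one)
  ultimately have "?s \<in> reduced_elements X r I"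
    using n keys sm m by (auto simp: reduced_elements_def monic_def)
  then show ?thesis
    using lead by blast
qed

text \<open>
  Division by \<open>S\<close>: the leading term of \<open>h\<close> is cancelled by some \<open>a s \<circ> u\<close>, and the remainder is in
  \<open>I\<close> with a smaller leading monomial. The bound on the terms is what the triviality of
  compositions asks for.
\<close>

lemma ideal_in_span_ctx_terms:
  assumes S: "S \<subseteq> I" "\<forall>s\<in>S. monic r s" "lead_set r I \<subseteq> multiples X (lead r ` S)"
    and h: "h \<in> I" "h \<noteq> 0"
  shows "h \<in> krig.span (ctx_terms X S
    (\<lambda>a s u. ctx_mon a (lead r s) u = lead r h \<or> ctx_mon a (lead r s) u \<prec> lead r h))"
  using h
proof (induction "lead r h" arbitrary: h rule: wfp_induct_rule[OF wfp_less])
  case (1 h)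
  let ?T = "\<lambda>h. ctx_terms X S
    (\<lambda>a s u. ctx_mon a (lead r s) u = lead r h \<or> ctx_mon a (lead r s) u \<prec> lead r h)"
  obtain a s u where as: "lead r h = ctx_mon a (lead r s) u" "a \<in> Mon X" "s \<in> S" "u \<in> Rig X"
    using ideal_nonzero[OF 1(2,3)] S(3) by (auto elim!: multiplesE)
  let ?p = "ctx a s u" and ?c = "Poly_Mapping.lookup h (lead r h)"
  have s: "s \<in> kRig X" "s \<noteq> 0" "monic r s"
    using as S ideal_subset by (auto simp: monic_def)
  have p: "?p \<in> kRig X" "?p \<in> I" "monic r ?p" "lead r ?p = lead r h"
    using s as S omega_ideal_ctx[OF ideal, of s a u]
    by (auto simp: ctx_in_kRig monic_ctx lead_ctx)
  let ?h = "h - scale ?c ?p"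
  have hI: "?h \<in> I"
    using 1(2) p by (intro krig.subspace_diff[OF subspace] krig.subspace_scale[OF subspace])
  have "?h \<in> krig.span (?T h)"
  proof (cases "?h = 0")
    case False
    have less: "lead r ?h \<prec> lead r h"
      using hI False ideal_subset cancel_lead_keys[of h ?p] p 1(2,3)
      by (intro lead_less_if_keys_less) auto
    then have "?T ?h \<subseteq> ?T h"
      by (intro ctx_terms_mono) (auto dest: less_trans)
    then show ?thesis
      using 1(1)[OF less hI False] krig.span_mono by blast
  qed (simp add: krig.span_zero)
  moreover have "?p \<in> ?T h"
    using as by (intro ctx_termsI) auto
  ultimately have "?h + scale ?c ?p \<in> krig.span (?T h)"
    by (intro krig.span_add krig.span_scale) (auto intro: krig.span_base)
  then show ?case
    by simp
qed

text \<open>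
  For monic elements of \<open>I\<close>, being a basis only depends on the leading monomials. A composition \<open>(f,g)\<^sub>w\<close> is an element
  of \<open>I\<close> below \<open>w\<close>, since both of its terms are monic with leading monomial \<open>w\<close>; dividing it by
  \<open>S\<close> shows it trivial.
\<close>

lemma GS_basis_forI:
  assumes S: "S \<subseteq> I" "\<forall>s\<in>S. monic r s" "lead_set r I \<subseteq> multiples X (lead r ` S)"
  shows "GS_basis_for X r S I"
proof -
  note span = ideal_in_span_ctx_terms[OF S]
  have combination: "h \<in> krig.span (ctx_terms X S (\<lambda>_ _ _. True))" if h: "h \<in> I" for h
  proof (cases "h = 0")
    case False
    show ?thesis
      by (rule subsetD[OF krig.span_mono[OF ctx_terms_mono] span[OF h False]]) simp
  qed (simp add: krig.span_zero)
  have "trivial_mod X r S w h" if fg: "f \<in> S" "g \<in> S" and comp: "is_composition r f g w h" for f g w h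
  proof (cases "h = 0")
    case False
    obtain u v a b U V where c: "u \<in># lead r f" "v \<in># lead r g" "a + u = u \<union># v" "b + v = u \<union># v"
       "w = ctx_mon a (lead r f) U" "w = ctx_mon b (lead r g) V" "h = ctx a f U - ctx b g V"
       and w: "w = lcm_circ (rig_times {#a#} (lead r f)) (rig_times {#b#} (lead r g))"
      using comp unfolding is_composition_def by blast
    have nz: "f \<in> kRig X" "f \<noteq> 0" "monic r f" "g \<in> kRig X" "g \<noteq> 0" "monic r g"
      using fg S ideal_subset by (auto simp: monic_def)
    \<comment> \<open>The cofactors of a composition are not constrained to \<open>X\<close>, but they divide monomials over \<open>X\<close>.\<close>
    have "u \<in> Mon X" "v \<in> Mon X"
      using c nz lead_in_Rig[of f] lead_in_Rig[of g] by (auto simp: Rig_def)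
    then have "u \<union># v \<in> Mon X"
      by (auto simp: Mon_def)
    then have ab: "a \<in> Mon X" "b \<in> Mon X"
      using c(3,4) by (metis Mon_add)+
    have "w \<in> Rig X"
      using ab nz lead_in_Rig ctx_mon_in_Rig[of a X "lead r f" "{#}"] ctx_mon_in_Rig[of b X "lead r g" "{#}"]
      by (auto simp: w lcm_circ_eq(1) rig_times_def ctx_mon_eq intro: Rig_subset[OF diff_subset_eq_self])
    then have UV: "U \<in> Rig X" "V \<in> Rig X"
      using c(5,6) Rig_add[of _ U X] Rig_add[of _ V X] by (metis ctx_mon_eq)+
    have lead: "lead r (ctx a f U) = w" "lead r (ctx b g V) = w"
      using nz ab UV c by (simp_all add: lead_ctx)
    have p: "ctx a f U \<in> kRig X" "ctx b g V \<in> kRig X" "monic r (ctx a f U)" "monic r (ctx b g V)"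
      using nz ab UV by (auto intro: ctx_in_kRig monic_ctx)
    have hI: "h \<in> I"
      unfolding c(7) using fg S ab UV omega_ideal_ctx[OF ideal]
      by (intro krig.subspace_diff[OF subspace]) auto
    have "lead r h \<prec> w"
    proof (rule lead_less_if_keys_less)
      show "v \<prec> w" if "v \<in> Poly_Mapping.keys h" for v
        using cancel_lead_keys[of "ctx a f U" "ctx b g V" v] p lead that by (auto simp: c(7) monic_def)
    qed (use hI ideal_subset False in auto)
    then show ?thesis
      unfolding trivial_mod_iff_span
      by (intro subsetD[OF krig.span_mono[OF ctx_terms_mono] span[OF hI False]]) (auto dest: less_trans)
  qed (simp add: trivial_mod_iff_span krig.span_zero)
  then have "GS_basis X r S"
    using S ideal_subset by (auto simp: GS_basis_def)
  moreover have "Id_gen X S = I"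
  proof
    show "Id_gen X S \<subseteq> I"
      unfolding Id_gen_def using S(1) ideal by (rule hull_minimal)
    have "I \<subseteq> J" if "S \<subseteq> J" "omega_ideal X J" for J
      using combination omega_ideal_span[OF that(2,1)] by blast
    then show "I \<subseteq> Id_gen X S"
      by (auto simp: Id_gen_def hull_def)
  qed
  ultimately show ?thesis
    using combination by (simp add: GS_basis_for_def is_combination_iff_span)
qed

lemma reduced_elements_basis: "reduced_GS_basis_for X r (reduced_elements X r I) I"
proof -
  let ?S = "reduced_elements X r I"
  have SI: "?S \<subseteq> I" and monic: "\<And>s. s \<in> ?S \<Longrightarrow> monic r s"
    by (auto simp: reduced_elements_def)
  have "minimal_monomials X (lead_set r I) \<subseteq> lead r ` ?S"
    using ex_reduced_element by blast
  then have "lead_set r I \<subseteq> multiples X (lead r ` ?S)"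
    using multiple_of_minimal_monomial[OF lead_set_subset] multiples_mono by blast
  then have "GS_basis_for X r ?S I"
    using SI monic by (intro GS_basis_forI) auto
  moreover have "v \<in> Irr X r (?S - {s})" if s: "s \<in> ?S" and v: "v \<in> Poly_Mapping.keys s" for s v
  proof -
    have "v \<in> Rig X"
      using s v SI ideal_subset by (auto simp: kRig_def)
    moreover have False if v': "v \<in> multiples X (lead r ` (?S - {s}))"
    proof -
      obtain t where t: "t \<in> ?S" "t \<noteq> s" "v \<in> multiples X {lead r t}"
        using multiples_of_one[OF v'] by blast
      have tL: "lead r t \<in> lead_set r I"
        using t by (auto simp: reduced_elements_def minimal_monomials_def)
      then have "v \<in> lead_set r I"
        using t(3) multiples_mono[of "{lead r t}" "lead_set r I" X] multiples_lead_set by blast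
      then have "v = lead r s"
        using s v by (auto simp: reduced_elements_def)
      then have "lead r t = lead r s"
        using s t(3) tL by (auto simp: reduced_elements_def minimal_monomials_def)
      then show False
        using reduced_elements_unique[OF t(1) s] t(2) by blast
    qed
    ultimately show ?thesis
      by (auto simp: Irr_eq)
  qed
  ultimately show ?thesis
    by (auto simp: reduced_GS_basis_for_def)
qed

end

theorem theorem4p4:
  fixes X :: "'x set"
    and r :: "'x rig rel"
    and I :: "('x, 'k::field) krig set"
  assumes "omega_ideal X I"
    and "monomial_ordering X r"
  shows "\<exists>!S. reduced_GS_basis_for X r S I"
proof -
  interpret krig_ideal X r I
    by unfold_locales (fact assms)+
  show ?thesis
    using reduced_elements_basis reduced_basis_eq by blast
qed

end
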